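(* For all integers $k\ge1$ and all non-identity induced Clifford permutations $A$ acting on $J_2^{S_{\Delta_{2k}}}$, the set of translation constants of $A$ equals its set of fixed points: $$\mathrm{TC}(A)=\mathrm{FP}(A).$$
   Context: $S_{\Delta_{2k}}=\mathbb{C}^{2^k}/(\mathbb{Z}^{2^k}\oplus i\mathbb{Z}^{2^k})$ and $J_2^{S_{\Delta_{2k}}}=\{x\in S_{\Delta_{2k}}:2x=0\}$; elements are vectors $\vec v$ of length $2^k$ with entries in $\{0,\frac12,\frac i2,\frac{1+i}2\}\subset\mathbb{C}/(\mathbb{Z}\oplus i\mathbb{Z})$. For $0\le j\le k-1$, divide $\{1,\dots,2^k\}$ into $2^{k-j}$ consecutive blocks of size $2^j$; the switch permutation $A_{2^j}$ interchanges the first and second blocks, the third and fourth blocks, etc., preserving order within each block. $(1)$ is the identity permutation. A permutation $\sigma$ of $\{1,\dots,2^k\}$ of order at most 2 acts on $J_2^{S_{\Delta_{2k}}}$ by $(\sigma\cdot\vec v)[m]=\vec v[\sigma(m)]$. $S_{1,\dots,k}$ denotes any map $S_k\circ\cdots\circ S_1$ with $S_l\in\{(1),A_{2^{l-1}}\}$ for $1\le l\le k$, and $i\cdot S_{1,\dots,k}$ denotes such a map followed by scalar multiplication by $i$. The induced Clifford permutations are the maps on $J_2^{S_{\Delta_{2k}}}$ of the form $S_{1,\dots,k}$ or $i\cdot S_{1,\dots,k}$ (these are exactly the maps by which the generators of the Clifford algebra $Cl(\mathbb{C}^{2k})$ and their negatives act on $J_2^{S_{\Delta_{2k}}}$). $\mathrm{FP}(A)=\{\vec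 v\in J_2^{S_{\Delta_{2k}}}:A\cdot\vec v=\vec v\}$, and $\mathrm{TC}(A)=\{\vec v\in J_2^{S_{\Delta_{2k}}}: A\cdot\vec w=\vec v+\vec w\text{ for some }\vec w\in J_2^{S_{\Delta_{2k}}}\}$. *)

theory Defs
  imports Complex_Main "HOL-Library.FuncSet" "HOL-Library.Function_Algebras"
begin

section \<open>The complex torus \<open>\<complex>/(\<int> \<oplus> i\<int>)\<close>\<close>

definition gauss_lattice :: "complex set" where
  "gauss_lattice = {of_int a + \<i> * of_int b | a b :: int. True}"

lemma gauss_lattice_iff: "z \<in> gauss_lattice \<longleftrightarrow> Re z \<in> \<int> \<and> Im z \<in> \<int>"
proof
  assume "z \<in> gauss_lattice"
  then show "Re z \<in> \<int> \<and> Im z \<in> \<int>" by (auto simp: gauss_lattice_def)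
next
  assume "Re z \<in> \<int> \<and> Im z \<in> \<int>"
  then obtain a b where "Re z = of_int a" "Im z = of_int b" by (auto elim!: Ints_cases)
  then have "z = of_int a + \<i> * of_int b" by (simp add: complex_eq_iff)
  then show "z \<in> gauss_lattice" by (auto simp: gauss_lattice_def)
qed

lemma gauss_lattice_0: "0 \<in> gauss_lattice"
  by (simp add: gauss_lattice_iff)

lemma gauss_lattice_add: "x \<in> gauss_lattice \<Longrightarrow> y \<in> gauss_lattice \<Longrightarrow> x + y \<in> gauss_lattice"
  by (simp add: gauss_lattice_iff)

lemma gauss_lattice_minus: "x \<in> gauss_lattice \<Longrightarrow> - x \<in> gauss_lattice"
  by (simp add: gauss_lattice_iff)

lemma gauss_lattice_times_i: "x \<in> gauss_lattice \<Longrightarrow> \<i> * x \<in> gauss_lattice"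
  by (simp add: gauss_lattice_iff)

definition gauss_rel :: "complex \<Rightarrow> complex \<Rightarrow> bool" where
  "gauss_rel z w \<longleftrightarrow> z - w \<in> gauss_lattice"

quotient_type torus = complex / gauss_rel
proof (rule equivpI)
  show "reflp gauss_rel" by (simp add: reflp_def gauss_rel_def gauss_lattice_0)
  show "symp gauss_rel"
    unfolding symp_def gauss_rel_def by (auto dest: gauss_lattice_minus)
  show "transp gauss_rel"
    unfolding transp_def gauss_rel_def
    by (auto dest: gauss_lattice_add)
qed

instantiation torus :: ab_group_add
begin

lift_definition zero_torus :: torus is 0 .

lift_definition plus_torus :: "torus \<Rightarrow> torus \<Rightarrow> torus" is "(+)"
  by (simp add: gauss_rel_def add_diff_add gauss_lattice_add)

lift_definition uminus_torus :: "torus \<Rightarrow> torus" is uminus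
proof -
  fix z w :: complex assume "gauss_rel z w"
  then have "- (z - w) \<in> gauss_lattice" unfolding gauss_rel_def by (rule gauss_lattice_minus)
  also have "- (z - w) = - z - - w" by simp
  finally show "gauss_rel (- z) (- w)" unfolding gauss_rel_def .
qed

lift_definition minus_torus :: "torus \<Rightarrow> torus \<Rightarrow> torus" is "(-)"
proof -
  fix z w z' w' :: complex assume "gauss_rel z w" "gauss_rel z' w'"
  then have "(z - w) + - (z' - w') \<in> gauss_lattice"
    unfolding gauss_rel_def by (intro gauss_lattice_add gauss_lattice_minus)
  also have "(z - w) + - (z' - w') = z - z' - (w - w')" by simp
  finally show "gauss_rel (z - z') (w - w')" unfolding gauss_rel_def .
qed

instance
  by standard (transfer; simp add: gauss_rel_def gauss_lattice_0 algebra_simps)+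

end

lift_definition torus_times_i :: "torus \<Rightarrow> torus" is "\<lambda>z. \<i> * z"
  unfolding gauss_rel_def right_diff_distrib[symmetric] by (rule gauss_lattice_times_i)


section \<open>The torus of dimension \<open>2 ^ k\<close> and its 2-torsion\<close>

text \<open>
  A vector of length \<open>2 ^ k\<close> is a function on \<open>nat\<close>, indexed by \<open>{1..2 ^ k}\<close> and equal to \<open>0\<close>
  elsewhere; addition is pointwise.
\<close>

definition spinor_torus :: "nat \<Rightarrow> (nat \<Rightarrow> torus) set" where
  "spinor_torus k = {v. \<forall>m. m \<notin> {1..2 ^ k} \<longrightarrow> v m = 0}"

text \<open>
  The lemmas \<open>torus_proj_add\<close>, \<open>torus_proj_image\<close> and \<open>torus_proj_eq_iff\<close> below
  identify \<open>spinor_torus k\<close> with the quotient of \<open>\<complex>\<close>-vectors of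
  length \<open>2 ^ k\<close> by the vectors with entries in \<open>\<int> \<oplus> i\<int>\<close>: coordinatewise projection is
  additive and surjective, and its fibres are the cosets.
\<close>

definition cvecs :: "nat \<Rightarrow> (nat \<Rightarrow> complex) set" where
  "cvecs k = {z. \<forall>m. m \<notin> {1..2 ^ k} \<longrightarrow> z m = 0}"

definition lattice_vecs :: "nat \<Rightarrow> (nat \<Rightarrow> complex) set" where
  "lattice_vecs k = {z \<in> cvecs k. \<forall>m. z m \<in> gauss_lattice}"

definition torus_proj :: "(nat \<Rightarrow> complex) \<Rightarrow> (nat \<Rightarrow> torus)" where
  "torus_proj z = (\<lambda>m. abs_torus (z m))"

lemma torus_proj_add: "torus_proj (z + w) = torus_proj z + torus_proj w"
  by (simp add: torus_proj_def fun_eq_iff plus_torus.abs_eq)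

lemma torus_proj_image: "torus_proj ` cvecs k = spinor_torus k"
proof
  show "torus_proj ` cvecs k \<subseteq> spinor_torus k"
    by (auto simp: torus_proj_def cvecs_def spinor_torus_def zero_torus.abs_eq)
next
  show "spinor_torus k \<subseteq> torus_proj ` cvecs k"
  proof
    fix v assume v: "v \<in> spinor_torus k"
    let ?z = "\<lambda>m. if m \<in> {1..2 ^ k} then rep_torus (v m) else 0"
    have "torus_proj ?z = v"
      using v Quotient_abs_rep[OF Quotient_torus]
      by (auto simp: torus_proj_def spinor_torus_def zero_torus.abs_eq fun_eq_iff)
    moreover have "?z \<in> cvecs k" by (simp add: cvecs_def)
    ultimately show "v \<in> torus_proj ` cvecs k" by (rule image_eqI[OF sym])
  qed
qed

lemma torus_proj_eq_iff:
  assumes "z \<in> cvecs k" "w \<in> cvecs k"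
  shows "torus_proj z = torus_proj w \<longleftrightarrow> z - w \<in> lattice_vecs k"
  using assms
  by (auto simp: torus_proj_def lattice_vecs_def cvecs_def fun_eq_iff torus.abs_eq_iff gauss_rel_def)

definition J2 :: "nat \<Rightarrow> (nat \<Rightarrow> torus) set" where
  "J2 k = {x \<in> spinor_torus k. x + x = 0}"

lemma Ints_double_iff: "r + r \<in> \<int> \<longleftrightarrow> r \<in> \<int> \<or> r - 1/2 \<in> \<int>" for r :: real
proof
  assume "r + r \<in> \<int>"
  then obtain m where m: "r + r = of_int m" by (rule Ints_cases)
  show "r \<in> \<int> \<or> r - 1/2 \<in> \<int>"
  proof (cases "even m")
    case True
    then obtain n where "m = 2 * n" by (rule evenE)
    with m have "r = of_int n" by simp
    then show ?thesis by simp
  next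
    case False
    then obtain n where "m = 2 * n + 1" by (rule oddE)
    with m have "r - 1/2 = of_int n" by simp
    then have "r - 1/2 \<in> \<int>" by (simp only: Ints_of_int)
    then show ?thesis ..
  qed
next
  assume "r \<in> \<int> \<or> r - 1/2 \<in> \<int>"
  then show "r + r \<in> \<int>"
  proof
    assume "r - 1/2 \<in> \<int>"
    then have "(r - 1/2) + (r - 1/2) + 1 \<in> \<int>" by (intro Ints_add Ints_1)
    then show ?thesis by simp
  qed (rule Ints_add)
qed

lemma torus_two_torsion_iff:
  "x + x = 0 \<longleftrightarrow>
    x \<in> {0, abs_torus (1/2), abs_torus (\<i>/2), abs_torus ((1 + \<i>)/2)}"
proof -
  obtain z where z: "x = abs_torus z" by (induct x rule: torus.abs_induct) blast
  have "x + x = 0 \<longleftrightarrow> Re z + Re z \<in> \<int> \<and> Im z + Im z \<in> \<int>"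
    by (simp only: z plus_torus.abs_eq zero_torus.abs_eq torus.abs_eq_iff gauss_rel_def
        gauss_lattice_iff) simp
  moreover have "x = 0 \<longleftrightarrow> Re z \<in> \<int> \<and> Im z \<in> \<int>"
    "x = abs_torus (1/2) \<longleftrightarrow> Re z - 1/2 \<in> \<int> \<and> Im z \<in> \<int>"
    "x = abs_torus (\<i>/2) \<longleftrightarrow> Re z \<in> \<int> \<and> Im z - 1/2 \<in> \<int>"
    "x = abs_torus ((1 + \<i>)/2) \<longleftrightarrow> Re z - 1/2 \<in> \<int> \<and> Im z - 1/2 \<in> \<int>"
    by (simp_all only: z zero_torus.abs_eq torus.abs_eq_iff gauss_rel_def gauss_lattice_iff)
       simp_all
  ultimately show ?thesis
    unfolding Ints_double_iff insert_iff empty_iff by argo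
qed

lemma J2_iff:
  "v \<in> J2 k \<longleftrightarrow>
    (\<forall>m \<in> {1..2 ^ k}. v m \<in> {0, abs_torus (1/2), abs_torus (\<i>/2), abs_torus ((1 + \<i>)/2)}) \<and>
    (\<forall>m. m \<notin> {1..2 ^ k} \<longrightarrow> v m = 0)"
proof -
  have "v + v = 0 \<longleftrightarrow> (\<forall>m. v m + v m = 0)" by (simp add: fun_eq_iff)
  then show ?thesis
    unfolding J2_def spinor_torus_def mem_Collect_eq torus_two_torsion_iff by blast
qed


section \<open>Induced Clifford permutations\<close>

text \<open>
  \<open>switch_perm k j\<close> is the switch permutation \<open>A\<^bsub>2^j\<^esub>\<close> of \<open>{1..2 ^ k}\<close>, for \<open>j < k\<close>: with blocks
  numbered from \<open>0\<close>, position \<open>m\<close> lies in block \<open>(m - 1) div 2 ^ j\<close>, and block \<open>2 * b\<close> is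
  interchanged with block \<open>2 * b + 1\<close>.
\<close>

definition switch_perm :: "nat \<Rightarrow> nat \<Rightarrow> nat \<Rightarrow> nat" where
  "switch_perm k j m =
    (if m \<notin> {1..2 ^ k} then m
     else if even ((m - 1) div 2 ^ j) then m + 2 ^ j
     else m - 2 ^ j)"

text \<open>
  This is used only for \<open>\<sigma>\<close> of order at most 2, so \<open>\<sigma>\<close> and its inverse give the same map.
\<close>

definition perm_act :: "(nat \<Rightarrow> nat) \<Rightarrow> (nat \<Rightarrow> torus) \<Rightarrow> (nat \<Rightarrow> torus)" where
  "perm_act \<sigma> v = (\<lambda>m. v (\<sigma> m))"

definition scale_i :: "(nat \<Rightarrow> torus) \<Rightarrow> (nat \<Rightarrow> torus)" where
  "scale_i v = (\<lambda>m. torus_times_i (v m))"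

text \<open>\<open>compose_acts \<sigma> n\<close> is the map \<open>\<sigma>\<^sub>n \<circ> \<dots> \<circ> \<sigma>\<^sub>1\<close>.\<close>

primrec compose_acts :: "(nat \<Rightarrow> nat \<Rightarrow> nat) \<Rightarrow> nat \<Rightarrow> (nat \<Rightarrow> torus) \<Rightarrow> (nat \<Rightarrow> torus)" where
  "compose_acts \<sigma> 0 = id"
| "compose_acts \<sigma> (Suc n) = perm_act (\<sigma> (Suc n)) \<circ> compose_acts \<sigma> n"

definition switch_choice :: "nat \<Rightarrow> (nat \<Rightarrow> nat \<Rightarrow> nat) \<Rightarrow> bool" where
  "switch_choice k \<sigma> \<longleftrightarrow> (\<forall>l \<in> {1..k}. \<sigma> l \<in> {id, switch_perm k (l - 1)})"

text \<open>
  These are maps on \<open>J2 k\<close>; as HOL functions they are \<open>undefined\<close> outside it, so that equality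
  of two of them means equality on \<open>J2 k\<close>.
\<close>

definition induced_clifford_perms :: "nat \<Rightarrow> ((nat \<Rightarrow> torus) \<Rightarrow> (nat \<Rightarrow> torus)) set" where
  "induced_clifford_perms k =
    {restrict (compose_acts \<sigma> k) (J2 k) | \<sigma>. switch_choice k \<sigma>} \<union>
    {restrict (scale_i \<circ> compose_acts \<sigma> k) (J2 k) | \<sigma>. switch_choice k \<sigma>}"

definition FP :: "nat \<Rightarrow> ((nat \<Rightarrow> torus) \<Rightarrow> (nat \<Rightarrow> torus)) \<Rightarrow> (nat \<Rightarrow> torus) set" where
  "FP k A = {v \<in> J2 k. A v = v}"

definition TC :: "nat \<Rightarrow> ((nat \<Rightarrow> torus) \<Rightarrow> (nat \<Rightarrow> torus)) \<Rightarrow> (nat \<Rightarrow> torus) set" where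
  "TC k A = {v \<in> J2 k. \<exists>w \<in> J2 k. A w = v + w}"

end

theory Submission imports Defs begin

text \<open>
  On \<open>J2 k\<close> every induced Clifford permutation \<open>A\<close> is an additive involution (scaling by \<open>i\<close> squares
  to \<open>-1 = 1\<close> there), so translation constants \<open>A w + w\<close> are fixed. Conversely, numbering
  positions from \<open>0\<close>, switches are XOR with powers of two, so the underlying permutation \<open>p\<close> is XOR
  with a mask: it is a fixed-point-free involution, or the identity. In the first case a
  fixed \<open>v\<close> is \<open>A w + w\<close> for \<open>w\<close> the restriction of \<open>v\<close> to one point of each orbit of \<open>p\<close>; in the second
  case \<open>A\<close> is scaling by \<open>i\<close>, whose fixed entries \<open>0\<close> and \<open>(1 + i)/2\<close> are \<open>i y + y\<close> with \<open>y = 0, 1/2\<close>.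
\<close>

section \<open>Switches as XOR with a mask\<close>

text \<open>The shift by one lets XOR act on \<open>{0..<2 ^ k}\<close>. The identity branch matches
  that of \<open>switch_perm\<close>, so the two can be equal as functions.\<close>

definition xor_perm :: "nat \<Rightarrow> nat \<Rightarrow> nat \<Rightarrow> nat" where
  "xor_perm k M m = (if m \<in> {1..2 ^ k} then Suc (xor (m - 1) M) else m)"

lemma xor_nat_less_power:
  fixes a b :: nat
  assumes "a < 2 ^ k" "b < 2 ^ k"
  shows "xor a b < 2 ^ k"
  using assms by (metis take_bit_nat_eq_self_iff take_bit_xor)

lemma xor_perm_in_range:
  assumes "M < 2 ^ k"
  shows "xor_perm k M m \<in> {1..2 ^ k} \<longleftrightarrow> m \<in> {1..2 ^ k}"
proof (cases "m \<in> {1..2 ^ k}")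
  case True
  then have "xor (m - 1) M < 2 ^ k"
    using assms by (intro xor_nat_less_power) auto
  with True show ?thesis by (simp add: xor_perm_def Suc_le_eq)
qed (simp only: xor_perm_def if_False)

text \<open>The bound on \<open>N\<close> keeps the inner value in range, where the outer map is XOR
  and not its identity branch.\<close>

lemma xor_perm_comp:
  assumes "N < 2 ^ k"
  shows "xor_perm k M (xor_perm k N m) = xor_perm k (xor N M) m"
proof (cases "m \<in> {1..2 ^ k}")
  case True
  then have "xor_perm k N m \<in> {1..2 ^ k}" using assms xor_perm_in_range by blast
  then show ?thesis using True by (simp add: xor_perm_def xor.assoc)
qed (simp only: xor_perm_def if_False)

lemma xor_perm_0: "xor_perm k 0 m = m"
  by (auto simp: xor_perm_def)

lemma xor_perm_involution: "M < 2 ^ k \<Longrightarrow> xor_perm k M (xor_perm k M m) = m"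
  by (simp add: xor_perm_comp xor_perm_0)

lemma xor_perm_no_fixed_point:
  assumes "M \<noteq> 0" "m \<in> {1..2 ^ k}"
  shows "xor_perm k M m \<noteq> m"
proof
  assume "xor_perm k M m = m"
  then have "xor (m - 1) M = m - 1" using assms(2) by (auto simp: xor_perm_def)
  then have "xor (m - 1) (xor (m - 1) M) = 0" by simp
  then show False using assms(1) by (simp add: xor.assoc[symmetric])
qed

text \<open>XOR with \<open>2 ^ j\<close> flips bit \<open>j\<close>, which is the parity of
  \<open>n div 2 ^ j\<close>; setting a clear bit adds \<open>2 ^ j\<close>, clearing a set one
  subtracts it.\<close>

lemma xor_power_of_two_nat:
  fixes n :: nat
  shows "xor n (2 ^ j) = (if even (n div 2 ^ j) then n + 2 ^ j else n - 2 ^ j)"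
proof (cases "bit n j")
  case True
  have "\<not> bit (unset_bit j n) j"
    by (simp add: bit_unset_bit_iff)
  moreover have "set_bit j (unset_bit j n) = n"
    using True by (intro bit_eqI) (auto simp: bit_set_bit_iff bit_unset_bit_iff)
  ultimately have "n = unset_bit j n + 2 ^ j" using set_bit_eq[of j "unset_bit j n"] by simp
  moreover have "xor n (2 ^ j) = unset_bit j n"
    using True flip_bit_eq_if[of j n] by (simp add: flip_bit_eq_xor push_bit_eq_mult)
  ultimately show ?thesis using True by (simp add: bit_iff_odd)
next
  case False
  then have "xor n (2 ^ j) = n + 2 ^ j"
    using flip_bit_eq_if[of j n] set_bit_eq[of j n] by (simp add: flip_bit_eq_xor push_bit_eq_mult)
  then show ?thesis using False by (simp add: bit_iff_odd)
qed

lemma switch_perm_eq_xor_perm: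
  "switch_perm k j = xor_perm k (2 ^ j)"
proof
  fix m
  show "switch_perm k j m = xor_perm k (2 ^ j) m"
  proof (cases "odd ((m - 1) div 2 ^ j)")
    case True
    then have "(m - 1) div 2 ^ j \<noteq> 0" by (metis even_zero)
    \<comment> \<open>Ensures that the truncated subtraction commutes with the shift by one:
      \<open>m - 2 ^ j = Suc (m - 1 - 2 ^ j)\<close>.\<close>
    then have "2 ^ j \<le> m - 1" by (simp add: div_eq_0_iff)
    then show ?thesis by (auto simp: switch_perm_def xor_perm_def xor_power_of_two_nat True)
  qed (auto simp: switch_perm_def xor_perm_def xor_power_of_two_nat)
qed

lemma compose_acts_xor_perm:
  assumes "switch_choice k \<sigma>" "n \<le> k"
  shows "\<exists>M < 2 ^ k. compose_acts \<sigma> n = perm_act (xor_perm k M)"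
  using assms(2)
proof (induction n)
  case 0
  have "compose_acts \<sigma> 0 = perm_act (xor_perm k 0)"
    by (simp add: fun_eq_iff perm_act_def xor_perm_0)
  then show ?case by (intro exI[of _ 0]) simp
next
  case (Suc n)
  then obtain M where M: "M < 2 ^ k" "compose_acts \<sigma> n = perm_act (xor_perm k M)" by auto
  have "\<sigma> (Suc n) \<in> {id, switch_perm k n}"
    using assms(1) Suc.prems by (force simp: switch_choice_def)
  moreover have "(2::nat) ^ n < 2 ^ k" using Suc.prems by simp
  moreover have "id = xor_perm k 0" by (simp add: fun_eq_iff xor_perm_0)
  ultimately obtain N where N: "N < 2 ^ k" "\<sigma> (Suc n) = xor_perm k N"
    unfolding switch_perm_eq_xor_perm
    by (metis (no_types) insertE singletonD zero_less_power zero_less_numeral)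
  \<comment> \<open>Acting on arguments reverses the order: the newest permutation meets the index
    first.\<close>
  have "compose_acts \<sigma> (Suc n) = perm_act (xor_perm k (xor N M))"
    using M N by (simp add: fun_eq_iff perm_act_def xor_perm_comp)
  then show ?case using xor_nat_less_power[OF N(1) M(1)] by blast
qed

section \<open>Additive involutions on the 2-torsion\<close>

lemma torus_times_i_add: "torus_times_i (x + y) = torus_times_i x + torus_times_i y"
  by transfer (simp add: gauss_rel_def gauss_lattice_0 algebra_simps)

lemma torus_times_i_0: "torus_times_i 0 = 0"
  by transfer (simp add: gauss_rel_def gauss_lattice_0)

lemma torus_times_i_square: "torus_times_i (torus_times_i x) = - x"
  by transfer (simp add: gauss_rel_def gauss_lattice_0 algebra_simps flip: mult.assoc)

lemma J2_altdef: "v \<in> J2 k \<longleftrightarrow> (\<forall>m. v m + v m = 0) \<and> (\<forall>m. m \<notin> {1..2 ^ k} \<longrightarrow> v m = 0)"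
  by (auto simp: J2_def spinor_torus_def fun_eq_iff)

lemma torus_times_i_fixed:
  assumes "x + x = 0" "torus_times_i x = x"
  shows "\<exists>y. y + y = 0 \<and> torus_times_i y + y = x"
proof -
  have half: "(1/2 :: real) \<notin> \<int>"
  proof
    assume "(1/2 :: real) \<in> \<int>"
    then obtain n where "1/2 = real_of_int n" by (rule Ints_cases)
    then have "2 * n = 1" by linarith
    then show False by presburger
  qed
  have half': "- (1/2 :: real) \<notin> \<int>" using half by (subst minus_in_Ints_iff)
  \<comment> \<open>Multiplication by \<open>\<i>\<close> swaps these two classes; in both cases
    \<open>\<i> * z - z\<close> has real part \<open>-1/2\<close>.\<close>
  have "x \<noteq> abs_torus (1/2)" "x \<noteq> abs_torus (\<i>/2)"
    using assms(2) half half'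
    by (auto simp: torus_times_i.abs_eq torus.abs_eq_iff gauss_rel_def gauss_lattice_iff)
  then consider "x = 0" | "x = abs_torus ((1 + \<i>)/2)"
    using assms(1) unfolding torus_two_torsion_iff by blast
  then show ?thesis
  proof cases
    case 1
    then show ?thesis by (intro exI[of _ 0]) (simp add: torus_times_i_0)
  next
    case 2
    have "torus_times_i (abs_torus (1/2)) + abs_torus (1/2) = x"
      by (simp add: 2 torus_times_i.abs_eq plus_torus.abs_eq add_divide_distrib add.commute)
    then show ?thesis by (intro exI[of _ "abs_torus (1/2)"]) (simp add: torus_two_torsion_iff)
  qed
qed

text \<open>Treats both kinds of map at once: \<open>c\<close> will be the identity or
  multiplication by \<open>\<i>\<close>. When \<open>p\<close> is trivial,
  \<open>A w + w = v\<close> has to be solved entry by entry.\<close>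

lemma TC_eq_FP_twisted_permutation:
  fixes A :: "(nat \<Rightarrow> torus) \<Rightarrow> nat \<Rightarrow> torus" and c :: "torus \<Rightarrow> torus"
  assumes A: "\<And>v m. v \<in> J2 k \<Longrightarrow> A v m = c (v (p m))"
    and p: "\<And>m. p m \<in> {1..2 ^ k} \<longleftrightarrow> m \<in> {1..2 ^ k}" "\<And>m. p (p m) = m"
    and c: "\<And>x y. c (x + y) = c x + c y" "\<And>x. x + x = 0 \<Longrightarrow> c (c x) = x"
    and free: "(\<forall>m \<in> {1..2 ^ k}. p m \<noteq> m) \<or>
      (\<forall>m. p m = m) \<and> (\<forall>x. x + x = 0 \<longrightarrow> c x = x \<longrightarrow> (\<exists>y. y + y = 0 \<and> c y + y = x))"
  shows "TC k A = FP k A"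
proof (intro equalityI subsetI)
  fix v assume "v \<in> TC k A"
  then obtain w where v: "v \<in> J2 k" and w: "w \<in> J2 k" and vw: "A w = v + w"
    by (auto simp: TC_def)
  have w2: "w m + w m = 0" for m using w by (simp add: J2_altdef)
  have v_eq: "v m = c (w (p m)) + w m" for m
  proof -
    have "c (w (p m)) = v m + w m" using vw A[OF w, of m] by simp
    then show ?thesis using w2[of m] by (simp add: add.assoc)
  qed
  \<comment> \<open>Applying \<open>c\<close> to \<open>v_eq\<close> at \<open>p m\<close> only
    interchanges its two summands.\<close>
  have "A v m = v m" for m
    using w2 by (simp add: A[OF v] v_eq p c add.commute)
  then show "v \<in> FP k A" using v by (auto simp: FP_def)
next
  fix v assume "v \<in> FP k A"
  then have v: "v \<in> J2 k" and "A v = v" by (auto simp: FP_def)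
  then have fixed: "c (v (p m)) = v m" for m using A[OF v, of m] by simp
  have v2: "v m + v m = 0" and v0: "m \<notin> {1..2 ^ k} \<Longrightarrow> v m = 0" for m
    using v by (auto simp: J2_altdef)
  have c0: "c 0 = 0" using c(1)[of 0 0] by simp
  have "\<exists>w \<in> J2 k. \<forall>m. v m = c (w (p m)) + w m"
    using free
  proof
    assume free: "\<forall>m \<in> {1..2 ^ k}. p m \<noteq> m"
    \<comment> \<open>Keeps \<open>v\<close> at the smaller point of each orbit. At either point
      exactly one summand of \<open>c (w (p m)) + w m\<close> survives, and it equals
      \<open>v m\<close> because \<open>v\<close> is fixed.\<close>
    define w where "w m = (if m < p m then v m else 0)" for m
    have "w \<in> J2 k" using v2 v0 by (auto simp: J2_altdef w_def)
    moreover have "v m = c (w (p m)) + w m" for m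
    proof (cases "m \<in> {1..2 ^ k}")
      case True
      then have "m < p m \<or> p m < m" using free by (meson linorder_neqE_nat)
      then show ?thesis using fixed by (auto simp: w_def p c0)
    next
      case False
      then have "v m = 0" "v (p m) = 0" using v0 p(1) by blast+
      then show ?thesis by (simp add: w_def c0)
    qed
    ultimately show ?thesis by blast
  next
    assume id: "(\<forall>m. p m = m) \<and>
      (\<forall>x. x + x = 0 \<longrightarrow> c x = x \<longrightarrow> (\<exists>y. y + y = 0 \<and> c y + y = x))"
    then have "\<forall>m. \<exists>y. y + y = 0 \<and> c y + y = v m" using v2 fixed by metis
    then obtain y where y: "\<And>m. y m + y m = 0 \<and> c (y m) + y m = v m" by metis
    \<comment> \<open>Outside the range \<open>y m\<close> only satisfies
      \<open>c (y m) + y m = 0\<close> and may be nonzero, so it is cut off.\<close>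
    define w where "w m = (if m \<in> {1..2 ^ k} then y m else 0)" for m
    have "w \<in> J2 k" using y by (auto simp: J2_altdef w_def)
    moreover have "v m = c (w (p m)) + w m" for m
    proof (cases "m \<in> {1..2 ^ k}")
      case True
      then show ?thesis using id y by (simp add: w_def)
    next
      case False
      then have "v m = 0" "w m = 0" using v0 by (simp_all only: w_def if_False)
      then show ?thesis using id by (simp add: c0)
    qed
    ultimately show ?thesis by blast
  qed
  then obtain w where w: "w \<in> J2 k" and vw: "\<And>m. v m = c (w (p m)) + w m" by blast
  have "w m + w m = 0" for m using w by (simp add: J2_altdef)
  then have "A w = v + w" by (simp add: fun_eq_iff A[OF w] vw add.assoc)
  then show "v \<in> TC k A" using v w by (auto simp: TC_def)
qed

theorem proposition6p6:
  fixes k :: nat and A :: "(nat \<Rightarrow> torus) \<Rightarrow> (nat \<Rightarrow> torus)"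
  assumes "k \<ge> 1"
    and "A \<in> induced_clifford_perms k"
    and "A \<noteq> restrict id (J2 k)"
  shows "TC k A = FP k A"
proof -
  obtain \<sigma> where \<sigma>: "switch_choice k \<sigma>"
    and A: "A = restrict (compose_acts \<sigma> k) (J2 k) \<or>
      A = restrict (scale_i \<circ> compose_acts \<sigma> k) (J2 k)"
    using assms(2) by (auto simp: induced_clifford_perms_def)
  obtain M where M: "M < 2 ^ k" and comp: "compose_acts \<sigma> k = perm_act (xor_perm k M)"
    using compose_acts_xor_perm[OF \<sigma> order_refl] by blast
  note perm = xor_perm_in_range[OF M] xor_perm_involution[OF M]
  from A show ?thesis
  proof
    assume A: "A = restrict (compose_acts \<sigma> k) (J2 k)"
    \<comment> \<open>With \<open>c\<close> the identity, \<open>c y + y\<close> is always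
      \<open>0\<close> on 2-torsion, so only the fixed-point-free alternative can serve
      here.\<close>
    have "M \<noteq> 0"
    proof
      assume "M = 0"
      then have "compose_acts \<sigma> k = id" by (simp add: comp fun_eq_iff perm_act_def xor_perm_0)
      then show False using A assms(3) by simp
    qed
    then show ?thesis
      using perm xor_perm_no_fixed_point
      by (intro TC_eq_FP_twisted_permutation[where c = "\<lambda>x. x" and p = "xor_perm k M"])
        (auto simp: A comp perm_act_def)
  next
    assume A: "A = restrict (scale_i \<circ> compose_acts \<sigma> k) (J2 k)"
    have Av: "A v m = torus_times_i (v (xor_perm k M m))" if "v \<in> J2 k" for v m
      using that by (simp add: A comp scale_i_def perm_act_def)
    have square: "torus_times_i (torus_times_i x) = x" if "x + x = 0" for x
      using that by (simp add: torus_times_i_square minus_unique)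
    have free: "(\<forall>m \<in> {1..2 ^ k}. xor_perm k M m \<noteq> m) \<or>
      (\<forall>m. xor_perm k M m = m) \<and>
      (\<forall>x. x + x = 0 \<longrightarrow> torus_times_i x = x \<longrightarrow> (\<exists>y. y + y = 0 \<and> torus_times_i y + y = x))"
      using xor_perm_no_fixed_point xor_perm_0 torus_times_i_fixed by metis
    show ?thesis
      by (rule TC_eq_FP_twisted_permutation[where p = "xor_perm k M" and c = torus_times_i])
        (fact Av perm torus_times_i_add square free)+
  qed
qed

end
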